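(* There exist choices of an integer $n>0$ and a permutation $w\in S_n$ for which the polynomial $\mathcal{KN}_w^{(\alpha,\beta,\gamma)}(\boldsymbol{x};\boldsymbol{0})$, expanded in monomials in $\alpha,\beta,\gamma,x_1,\ldots,x_n$, has negative coefficients.
   Context: $\alpha,\beta,\gamma,x_1,\ldots,x_n$ are indeterminates. Let $\partial_i(f)=\dfrac{f(x_1,\ldots,x_{i-1},x_{i+1},x_i,x_{i+2},\ldots,x_n)-f(x_1,\ldots,x_n)}{x_{i+1}-x_i}$ and, for $1\le i\le n-1$, $$T_i^{(\alpha,\beta,\gamma)}=-\beta+\big((\alpha+\beta+\gamma)x_i+\gamma x_{i+1}+1+(\beta+\gamma)(\alpha+\gamma)x_ix_{i+1}\big)\partial_i .$$ These operators satisfy the braid relations, so $T_w^{(\alpha,\beta,\gamma)}=T_{i_1}^{(\alpha,\beta,\gamma)}\circ\cdots\circ T_{i_\ell}^{(\alpha,\beta,\gamma)}$ is well defined for any reduced decomposition $w=s_{i_1}\cdots s_{i_\ell}\in S_n$. Then $\mathcal{KN}_w^{(\alpha,\beta,\gamma)}(\boldsymbol{x};\boldsymbol{0})=T_w^{(\alpha,\beta,\gamma)}(x_1^{n-1}x_2^{n-2}\cdots x_{n-1})$, a polynomial with integer coefficients in $\alpha,\beta,\gamma,x_1,\ldots,x_n$. *)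

theory Defs
  imports "HOL-Library.Poly_Mapping" "HOL-Combinatorics.Permutations"
begin

datatype indet = Alpha | Beta | Gamma | X nat

text \<open>
  An arbitrary linear order on the indeterminates, needed only because the library derives
  the integral domain property of polynomial rings from an order on monomials.
\<close>

fun indet_code :: "indet \<Rightarrow> nat" where
  "indet_code Alpha = 0"
| "indet_code Beta = 1"
| "indet_code Gamma = 2"
| "indet_code (X i) = i + 3"

lemma indet_code_inject: "indet_code u = indet_code v \<longleftrightarrow> u = v"
  by (cases u; cases v) auto

instantiation indet :: linorder
begin

definition less_eq_indet :: "indet \<Rightarrow> indet \<Rightarrow> bool" where
  "u \<le> v \<longleftrightarrow> indet_code u \<le> indet_code v"

definition less_indet :: "indet \<Rightarrow> indet \<Rightarrow> bool" where
  "u < v \<longleftrightarrow> indet_code u < indet_code v"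

instance
  by standard (auto simp: less_eq_indet_def less_indet_def indet_code_inject)

end

type_synonym monomial = "indet \<Rightarrow>\<^sub>0 nat"
type_synonym polynomial = "monomial \<Rightarrow>\<^sub>0 int"

definition Var :: "indet \<Rightarrow> polynomial" where
  "Var v = Poly_Mapping.single (Poly_Mapping.single v 1) 1"

abbreviation alpha :: polynomial where "alpha \<equiv> Var Alpha"
abbreviation beta :: polynomial where "beta \<equiv> Var Beta"
abbreviation gamma :: polynomial where "gamma \<equiv> Var Gamma"
abbreviation x :: "nat \<Rightarrow> polynomial" where "x i \<equiv> Var (X i)"

abbreviation coeff :: "polynomial \<Rightarrow> monomial \<Rightarrow> int" where
  "coeff \<equiv> Poly_Mapping.lookup"

text \<open>
  \<open>map_key\<close> precomposes with its argument, so the coefficient of a monomial \<open>m\<close> in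
  \<open>swap_vars i f\<close> is the coefficient in \<open>f\<close> of \<open>m\<close> with the exponents of
  \<open>x i\<close> and \<open>x (i + 1)\<close> exchanged.
\<close>

definition swap_monomial :: "nat \<Rightarrow> monomial \<Rightarrow> monomial" where
  "swap_monomial i = Poly_Mapping.map_key (transpose (X i) (X (i + 1)))"

definition swap_vars :: "nat \<Rightarrow> polynomial \<Rightarrow> polynomial" where
  "swap_vars i = Poly_Mapping.map_key (swap_monomial i)"

text \<open>The division is exact; existence and uniqueness of the quotient are proved below.\<close>

definition divided_difference :: "nat \<Rightarrow> polynomial \<Rightarrow> polynomial" where
  "divided_difference i f = (THE g. g * (x (i + 1) - x i) = swap_vars i f - f)"

lemma swap_monomial_involution [simp]: "swap_monomial i (swap_monomial i m) = m"
  by (simp add: swap_monomial_def map_key_compose transpose_comp_involutory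
      map_key_id[unfolded id_def[symmetric]])

lemma inj_swap_monomial: "inj (swap_monomial i)"
  by (metis injI swap_monomial_involution)

lemma swap_monomial_plus: "swap_monomial i (a + b) = swap_monomial i a + swap_monomial i b"
  by (simp add: swap_monomial_def map_key_plus)

lemma swap_monomial_single:
  "swap_monomial i (Poly_Mapping.single v k) =
     Poly_Mapping.single (transpose (X i) (X (i + 1)) v) k"
  using map_key_single[of "transpose (X i) (X (i + 1))" "transpose (X i) (X (i + 1)) v" k]
  by (simp add: swap_monomial_def)

lemma swap_vars_plus: "swap_vars i (f + g) = swap_vars i f + swap_vars i g"
  by (simp add: swap_vars_def map_key_plus inj_swap_monomial)

lemma swap_vars_single:
  "swap_vars i (Poly_Mapping.single m c) = Poly_Mapping.single (swap_monomial i m) c"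
  using map_key_single[OF inj_swap_monomial, of i "swap_monomial i m" c]
  by (simp add: swap_vars_def)

lemma swap_vars_Var: "swap_vars i (Var v) = Var (transpose (X i) (X (i + 1)) v)"
  by (simp only: Var_def swap_vars_single swap_monomial_single)

lemma divided_difference_exists: "x (i + 1) - x i dvd swap_vars i f - f"
proof -
  let ?d = "x (i + 1) - x i"
  have monom: "?d dvd swap_vars i (Poly_Mapping.single m 1) - Poly_Mapping.single m 1" for m
  proof (induction "sum (Poly_Mapping.lookup m) (Poly_Mapping.keys m)" arbitrary: m
      rule: less_induct)
    case less
    show ?case
    proof (cases "Poly_Mapping.keys m = {}")
      case True
      then have "m = 0" by simp
      then show ?thesis
        by (simp add: swap_vars_single swap_monomial_def del: single_one)
    next
      case False
      then obtain v where v: "v \<in> Poly_Mapping.keys m" by blast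
      define m' where "m' = m - Poly_Mapping.single v 1"
      have pos: "Poly_Mapping.lookup m v > 0"
        using v by (simp add: in_keys_iff)
      have m: "m = Poly_Mapping.single v 1 + m'"
        using pos by (intro poly_mapping_eqI)
          (auto simp: m'_def lookup_add lookup_minus lookup_single when_def)
      have sub: "Poly_Mapping.keys m' \<subseteq> Poly_Mapping.keys m"
        by (auto simp: m in_keys_iff lookup_add)
      have "sum (Poly_Mapping.lookup m') (Poly_Mapping.keys m') =
            sum (Poly_Mapping.lookup m') (Poly_Mapping.keys m)"
        by (rule sum.mono_neutral_left) (use sub in \<open>auto simp: in_keys_iff\<close>)
      also have "\<dots> < sum (Poly_Mapping.lookup m) (Poly_Mapping.keys m)"
        by (rule sum_strict_mono_ex1)
          (use v in \<open>auto simp: m lookup_add lookup_single when_def intro!: bexI[of _ v]\<close>)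
      finally have IH: "?d dvd swap_vars i (Poly_Mapping.single m' 1) - Poly_Mapping.single m' 1"
        by (rule less.hyps)
      define g where "g = (Poly_Mapping.single m' 1 :: polynomial)"
      have f: "Poly_Mapping.single m 1 = Var v * g"
        by (simp add: m Var_def g_def mult_single)
      have s: "swap_vars i (Poly_Mapping.single m 1) = swap_vars i (Var v) * swap_vars i g"
        unfolding Var_def g_def m swap_vars_single mult_single swap_monomial_plus by simp
      have "swap_vars i (Var v) - Var v \<in> {?d, - ?d, 0}"
        by (auto simp: swap_vars_Var transpose_def)
      then have "?d dvd swap_vars i (Var v) - Var v"
        by (auto simp del: minus_diff_eq)
      moreover have "swap_vars i (Var v) * swap_vars i g - Var v * g =
          (swap_vars i (Var v) - Var v) * swap_vars i g + Var v * (swap_vars i g - g)"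
        by (simp add: algebra_simps)
      ultimately show ?thesis
        unfolding f s[unfolded f] using IH[folded g_def] by simp
    qed
  qed
  show ?thesis
  proof (induction f rule: update_induct)
    case const
    show ?case by (simp add: swap_vars_def map_key_zero inj_swap_monomial)
  next
    case (update f m c)
    have c1: "Poly_Mapping.single m c = Poly_Mapping.single 0 c * Poly_Mapping.single m 1"
      by (simp add: mult_single)
    have c2: "swap_vars i (Poly_Mapping.single m c) =
        Poly_Mapping.single 0 c * swap_vars i (Poly_Mapping.single m 1)"
      by (simp add: swap_vars_single mult_single)
    have upd: "Poly_Mapping.update m c f = Poly_Mapping.single m c + f"
      using update.hyps(1) by (intro poly_mapping_eqI)
        (auto simp: lookup_update lookup_add lookup_single when_def in_keys_iff)
    have "swap_vars i (Poly_Mapping.update m c f) - Poly_Mapping.update m c f =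
        Poly_Mapping.single 0 c *
          (swap_vars i (Poly_Mapping.single m 1) - Poly_Mapping.single m 1)
        + (swap_vars i f - f)"
      unfolding upd swap_vars_plus c2 right_diff_distrib c1[symmetric]
      by (simp add: algebra_simps)
    then show ?case using monom[of m] update.IH by simp
  qed
qed

lemma x_neq: "i \<noteq> j \<Longrightarrow> x i \<noteq> x j"
  unfolding Var_def
  by (metis indet.inject lookup_single_eq lookup_single_not_eq zero_neq_one)

lemma divided_difference_unique:
  "\<exists>!g. g * (x (i + 1) - x i) = swap_vars i f - f"
proof -
  obtain g where g: "g * (x (i + 1) - x i) = swap_vars i f - f"
    using divided_difference_exists[of i f] by (metis dvd_def mult.commute)
  have "x (i + 1) - x i \<noteq> 0"
    using x_neq[of "i + 1" i] by simp
  then show ?thesis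
    using g by (metis mult_right_cancel)
qed

lemma divided_difference:
  "divided_difference i f * (x (i + 1) - x i) = swap_vars i f - f"
  unfolding divided_difference_def by (rule theI'[OF divided_difference_unique])

definition T :: "nat \<Rightarrow> polynomial \<Rightarrow> polynomial" where
  "T i f = - beta * f +
     ((alpha + beta + gamma) * x i + gamma * x (i + 1) + 1
        + (beta + gamma) * (alpha + gamma) * x i * x (i + 1)) * divided_difference i f"

definition word_perm :: "nat list \<Rightarrow> nat \<Rightarrow> nat" where
  "word_perm is = foldr (\<lambda>i p. transpose i (i + 1) \<circ> p) is id"

definition word_for :: "nat \<Rightarrow> (nat \<Rightarrow> nat) \<Rightarrow> nat list \<Rightarrow> bool" where
  "word_for n w is \<longleftrightarrow> set is \<subseteq> {1..<n} \<and> word_perm is = w"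

definition reduced_word :: "nat \<Rightarrow> (nat \<Rightarrow> nat) \<Rightarrow> nat list \<Rightarrow> bool" where
  "reduced_word n w is \<longleftrightarrow>
     word_for n w is \<and> (\<forall>js. word_for n w js \<longrightarrow> length is \<le> length js)"

text \<open>
  The operators \<open>T i\<close> satisfy the braid relations, so by Matsumoto's theorem the choice of
  reduced word is immaterial.
\<close>

definition T_perm :: "nat \<Rightarrow> (nat \<Rightarrow> nat) \<Rightarrow> polynomial \<Rightarrow> polynomial" where
  "T_perm n w = foldr T (SOME is. reduced_word n w is)"

definition KN :: "nat \<Rightarrow> (nat \<Rightarrow> nat) \<Rightarrow> polynomial" where
  "KN n w = T_perm n w (\<Prod>i = 1..n. x i ^ (n - i))"

end

theory Submission
  imports Defs HOL.Rat
begin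

text \<open>
  A polynomial without negative coefficients takes no negative value at a point with nonnegative
  coordinates. So it suffices to exhibit a permutation and such a point where the polynomial is
  negative (\<open>negative_coeff_if_eval_negative\<close>). This works with \<open>n = 4\<close> and
  \<open>w = s\<^sub>2 s\<^sub>3 s\<^sub>1 s\<^sub>2 s\<^sub>1\<close>, whose polynomial at \<open>\<alpha> = 0\<close> is, up to order 1 in \<open>\<gamma>\<close>,
  \<open>x\<^sub>1 + \<gamma> (q - \<beta>\<^sup>2 (1 + \<beta> x\<^sub>1) x\<^sub>1 x\<^sub>2 x\<^sub>3 x\<^sub>4)\<close>,
  where \<open>q\<close> has nonnegative coefficients and degree 1 in \<open>\<beta>\<close>. For large \<open>\<beta>\<close> the coefficient of
  \<open>\<gamma>\<close> is therefore very negative, and a small \<open>\<gamma>\<close> keeps the higher orders in \<open>\<gamma>\<close> from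
  compensating it. At \<open>x = (1, 2, 3, 4)\<close> and \<open>\<beta> = 4\<close> the first two terms are
  \<open>1 - 1751 \<gamma>\<close>, and \<open>\<gamma> = 1/100\<close> leaves a total of about \<open>-12.8\<close>.

  The value is computed without expanding the polynomial. As long as the \<open>x\<^sub>i\<close> have distinct
  values, the value of \<open>T i f\<close> at a point is a combination of the values of \<open>f\<close> at that point
  and at the point with \<open>x\<^sub>i\<close> and \<open>x\<^sub>i\<^sub>+\<^sub>1\<close> exchanged (\<open>eval_T\<close>). Hence five operators reduce the
  value to values of the staircase monomial at rearrangements of the point.

  The polynomial of \<open>w\<close> is defined by an unspecified reduced word. Since \<open>w\<close> has only five
  words of length at most 5 (\<open>short_words_of_witness\<close>), all of them are evaluated, which takes
  the place of the braid relations.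
\<close>

lemma polynomial_induct [case_names single plus]:
  fixes f :: "'a \<Rightarrow>\<^sub>0 'b::monoid_add"
  assumes single: "\<And>m c. P (Poly_Mapping.single m c)"
    and plus: "\<And>f g. P f \<Longrightarrow> P g \<Longrightarrow> P (f + g)"
  shows "P f"
proof (induction f rule: update_induct)
  case const
  show ?case using single[of undefined 0] by simp
next
  case (update f m c)
  have "Poly_Mapping.update m c f = Poly_Mapping.single m c + f"
    using update.hyps(1) by (intro poly_mapping_eqI)
      (auto simp: lookup_update lookup_add lookup_single when_def in_keys_iff)
  then show ?case using plus[OF single update.IH] by simp
qed

definition eval_monomial :: "(indet \<Rightarrow> rat) \<Rightarrow> monomial \<Rightarrow> rat" where
  "eval_monomial p m = (\<Prod>v\<in>Poly_Mapping.keys m. p v ^ Poly_Mapping.lookup m v)"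

definition eval_poly :: "(indet \<Rightarrow> rat) \<Rightarrow> polynomial \<Rightarrow> rat" where
  "eval_poly p f = (\<Sum>m\<in>Poly_Mapping.keys f. of_int (coeff f m) * eval_monomial p m)"

text \<open>
  Two summands and their sum have different supports; enlarging the index sets to a common one
  lets their evaluations be compared factor by factor and term by term.
\<close>

lemma eval_monomial_superset:
  assumes "finite S" "Poly_Mapping.keys m \<subseteq> S"
  shows "eval_monomial p m = (\<Prod>v\<in>S. p v ^ Poly_Mapping.lookup m v)"
  unfolding eval_monomial_def
  by (rule prod.mono_neutral_left) (use assms in \<open>auto simp: in_keys_iff\<close>)

lemma eval_superset:
  assumes "finite S" "Poly_Mapping.keys f \<subseteq> S"
  shows "eval_poly p f = (\<Sum>m\<in>S. of_int (coeff f m) * eval_monomial p m)"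
  unfolding eval_poly_def
  by (rule sum.mono_neutral_left) (use assms in \<open>auto simp: in_keys_iff\<close>)

lemma eval_monomial_plus: "eval_monomial p (a + b) = eval_monomial p a * eval_monomial p b"
proof -
  let ?S = "Poly_Mapping.keys a \<union> Poly_Mapping.keys b"
  have "Poly_Mapping.keys (a + b) \<subseteq> ?S" by (rule keys_add)
  then show ?thesis
    by (simp add: eval_monomial_superset[of ?S] lookup_add power_add prod.distrib)
qed

lemma eval_plus: "eval_poly p (f + g) = eval_poly p f + eval_poly p g"
proof -
  let ?S = "Poly_Mapping.keys f \<union> Poly_Mapping.keys g"
  have "Poly_Mapping.keys (f + g) \<subseteq> ?S" by (rule keys_add)
  then show ?thesis
    by (simp add: eval_superset[of ?S] lookup_add algebra_simps sum.distrib)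
qed

lemma eval_single: "eval_poly p (Poly_Mapping.single m c) = of_int c * eval_monomial p m"
  by (simp add: eval_superset[of "{m}"])

lemma eval_Var: "eval_poly p (Var v) = p v"
  by (simp add: Var_def eval_single eval_monomial_superset[of "{v}"])

lemma eval_one: "eval_poly p 1 = 1"
  using eval_single[of p 0 1] by (simp add: eval_monomial_def)

lemma eval_uminus: "eval_poly p (- f) = - eval_poly p f"
  by (simp add: eval_poly_def sum_negf)

lemma eval_minus: "eval_poly p (f - g) = eval_poly p f - eval_poly p g"
  using eval_plus[of p f "- g"] by (simp add: eval_uminus)

lemma eval_mult: "eval_poly p (f * g) = eval_poly p f * eval_poly p g"
proof (induction f rule: polynomial_induct)
  case (single m c)
  show ?case
    by (induction g rule: polynomial_induct)
      (simp_all add: mult_single eval_single eval_monomial_plus eval_plus distrib_left)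
qed (simp add: eval_plus distrib_right)

lemma eval_power: "eval_poly p (f ^ k) = eval_poly p f ^ k"
  by (induction k) (simp_all add: eval_one eval_mult)

lemma eval_monomial_swap:
  "eval_monomial p (swap_monomial i m) = eval_monomial (p \<circ> transpose (X i) (X (i + 1))) m"
proof (induction m rule: polynomial_induct)
  case (single v k)
  show ?case
    by (simp add: swap_monomial_single eval_monomial_superset[of "{v}"]
        eval_monomial_superset[of "{transpose (X i) (X (i + 1)) v}"])
qed (simp add: swap_monomial_plus eval_monomial_plus)

lemma eval_swap_vars: "eval_poly p (swap_vars i f) = eval_poly (p \<circ> transpose (X i) (X (i + 1))) f"
  by (induction f rule: polynomial_induct)
    (simp_all add: swap_vars_single eval_single eval_monomial_swap comp_def swap_vars_plus eval_plus)

lemma negative_coeff_if_eval_negative: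
  assumes "\<And>v. p v \<ge> 0" and "eval_poly p f < 0"
  shows "\<exists>m. coeff f m < 0"
proof (rule ccontr)
  assume "\<not> ?thesis"
  then have "eval_poly p f \<ge> 0"
    unfolding eval_poly_def eval_monomial_def
    by (intro sum_nonneg mult_nonneg_nonneg prod_nonneg) (auto simp: not_less assms(1))
  with assms(2) show False by simp
qed

text \<open>
  At \<open>\<alpha> = 0\<close> the coefficient of \<open>\<partial>\<^sub>i\<close> in the operator is
  \<open>c(x\<^sub>i, x\<^sub>i\<^sub>+\<^sub>1) = (1 + (\<beta> + \<gamma>) x\<^sub>i) (1 + \<gamma> x\<^sub>i\<^sub>+\<^sub>1)\<close>, and adding \<open>\<beta> (x\<^sub>i\<^sub>+\<^sub>1 - x\<^sub>i)\<close> to it exchanges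
  its two arguments. So the summand \<open>- \<beta> f\<close> is absorbed and
  \<open>T\<^sub>i f = \<partial>\<^sub>i (c(x\<^sub>i\<^sub>+\<^sub>1, x\<^sub>i) f)\<close>, whose defining quotient can be evaluated termwise wherever the
  denominator does not vanish.
\<close>

lemma eval_T:
  assumes "p Alpha = 0" and "p (X i) \<noteq> p (X (i + 1))"
  defines "c \<equiv> \<lambda>a b. (1 + (p Beta + p Gamma) * a) * (1 + p Gamma * b)"
  shows "eval_poly p (T i f) =
    (c (p (X i)) (p (X (i + 1))) * eval_poly (p \<circ> transpose (X i) (X (i + 1))) f
      - c (p (X (i + 1))) (p (X i)) * eval_poly p f) / (p (X (i + 1)) - p (X i))"
proof -
  have "eval_poly p (divided_difference i f) * (p (X (i + 1)) - p (X i)) =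
      eval_poly (p \<circ> transpose (X i) (X (i + 1))) f - eval_poly p f"
    using arg_cong[OF divided_difference[of i f], of "eval_poly p"]
    by (simp only: eval_mult eval_minus eval_Var eval_swap_vars)
  then have "eval_poly (p \<circ> transpose (X i) (X (i + 1))) f =
      eval_poly p f + eval_poly p (divided_difference i f) * (p (X (i + 1)) - p (X i))"
    by simp
  moreover have "eval_poly p (T i f) =
      - p Beta * eval_poly p f + ((p Beta + p Gamma) * p (X i) + p Gamma * p (X (i + 1)) + 1
        + (p Beta + p Gamma) * p Gamma * p (X i) * p (X (i + 1))) * eval_poly p (divided_difference i f)"
    by (simp only: T_def eval_mult eval_plus eval_uminus eval_one eval_Var assms(1) add_0)
  ultimately show ?thesis
    using assms(2) by (simp add: c_def eq_divide_eq) (simp add: algebra_simps)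
qed

text \<open>
  The coordinates of \<open>x\<^sub>1, \<dots>, x\<^sub>4\<close> remain parameters because the operators permute them; the
  values \<open>\<alpha> = 0\<close>, \<open>\<beta> = 4\<close> and \<open>\<gamma> = 1/100\<close> are shared by all points that occur.
\<close>

definition point :: "rat \<Rightarrow> rat \<Rightarrow> rat \<Rightarrow> rat \<Rightarrow> indet \<Rightarrow> rat" where
  "point a b c d v =
     (if v = Beta then 4 else if v = Gamma then 1 / 100
      else if v = X 1 then a else if v = X 2 then b
      else if v = X 3 then c else if v = X 4 then d else 0)"

text \<open>The factor \<open>c\<close> of \<open>eval_T\<close> for these values, with \<open>\<beta> + \<gamma> = 401/100\<close>.\<close>

definition weight :: "rat \<Rightarrow> rat \<Rightarrow> rat" where
  "weight a b = (1 + 401 / 100 * a) * (1 + 1 / 100 * b)"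

lemma eval_T_point:
  "a \<noteq> b \<Longrightarrow> eval_poly (point a b c d) (T 1 f) =
     (weight a b * eval_poly (point b a c d) f - weight b a * eval_poly (point a b c d) f) / (b - a)"
  "b \<noteq> c \<Longrightarrow> eval_poly (point a b c d) (T 2 f) =
     (weight b c * eval_poly (point a c b d) f - weight c b * eval_poly (point a b c d) f) / (c - b)"
  "c \<noteq> d \<Longrightarrow> eval_poly (point a b c d) (T 3 f) =
     (weight c d * eval_poly (point a b d c) f - weight d c * eval_poly (point a b c d) f) / (d - c)"
proof -
  have swap:
    "point a b c d \<circ> transpose (X 1) (X 2) = point b a c d"
    "point a b c d \<circ> transpose (X 2) (X 3) = point a c b d"
    "point a b c d \<circ> transpose (X 3) (X 4) = point a b d c"
    by (auto simp: fun_eq_iff point_def transpose_def)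
  show "a \<noteq> b \<Longrightarrow> eval_poly (point a b c d) (T 1 f) =
     (weight a b * eval_poly (point b a c d) f - weight b a * eval_poly (point a b c d) f) / (b - a)"
    using eval_T[of "point a b c d" 1 f]
    by (simp add: swap[unfolded One_nat_def] numeral_2_eq_2[symmetric])
      (simp add: point_def weight_def)
  show "b \<noteq> c \<Longrightarrow> eval_poly (point a b c d) (T 2 f) =
     (weight b c * eval_poly (point a c b d) f - weight c b * eval_poly (point a b c d) f) / (c - b)"
    using eval_T[of "point a b c d" 2 f]
    by (simp add: swap) (simp add: point_def weight_def)
  show "c \<noteq> d \<Longrightarrow> eval_poly (point a b c d) (T 3 f) =
     (weight c d * eval_poly (point a b d c) f - weight d c * eval_poly (point a b c d) f) / (d - c)"
    using eval_T[of "point a b c d" 3 f]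
    by (simp add: swap) (simp add: point_def weight_def)
qed

lemma eval_staircase_point:
  "eval_poly (point a b c d) (\<Prod>i = 1..4. x i ^ (4 - i)) = a ^ 3 * b ^ 2 * c"
proof -
  have "{1..4::nat} = {1, 2, 3, 4}" by auto
  then show ?thesis
    by (simp add: eval_mult eval_power eval_Var eval_one) (simp add: point_def)
qed

definition witness_words :: "nat list list" where
  "witness_words =
     [[2, 3, 1, 2, 1], [2, 1, 3, 2, 1], [2, 3, 2, 1, 2], [3, 2, 3, 1, 2], [3, 2, 1, 3, 2]]"

definition witness :: "nat \<Rightarrow> nat" where
  "witness = word_perm [2, 3, 1, 2, 1]"

text \<open>
  By the braid relations the value is the same for each of the five words. Unfolding one word
  takes at most 32 evaluations of the staircase monomial, and every rearrangement of
  \<open>(1, 2, 3, 4)\<close> has distinct entries, so that the quotients of \<open>eval_T_point\<close> always apply.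
\<close>

lemma eval_witness_words:
  assumes "is \<in> set witness_words"
  shows "eval_poly (point 1 2 3 4) (foldr T is (\<Prod>i = 1..4. x i ^ (4 - i))) < 0"
  using assms
  by (auto simp: witness_words_def eval_T_point eval_staircase_point weight_def
      simp del: One_nat_def)

text \<open>
  There are only \<open>3\<^sup>0 + \<dots> + 3\<^sup>5 = 364\<close> candidates, and comparing the images of
  \<open>1, \<dots>, 4\<close> is enough to discard all but five.
\<close>

lemma short_words_of_witness:
  assumes "set is \<subseteq> {1..<4}" "length is \<le> 5" "word_perm is = witness"
  shows "is \<in> set witness_words"
proof -
  have check: "\<forall>is \<in> set (concat (map (\<lambda>k. List.n_lists k [1, 2, 3]) [0..<6])).
      map (word_perm is) [1, 2, 3, 4] = map witness [1, 2, 3, 4] \<longrightarrow> is \<in> set witness_words"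
    by code_simp
  have "{1..<4::nat} = set [1, 2, 3]" by auto
  then have "is \<in> set (concat (map (\<lambda>k. List.n_lists k [1, 2, 3]) [0..<6]))"
    using assms(1,2) by (auto simp: set_n_lists)
  moreover have "map (word_perm is) [1, 2, 3, 4] = map witness [1, 2, 3, 4]"
    by (simp only: assms(3))
  ultimately show ?thesis using check by blast
qed

lemma word_perm_permutes: "set is \<subseteq> {1..<n} \<Longrightarrow> word_perm is permutes {1..n}"
proof (induction "is")
  case Nil
  show ?case by (simp add: word_perm_def permutes_def)
next
  case (Cons i "is")
  then have "transpose i (i + 1) permutes {1..n}"
    by (intro permutes_swap_id) auto
  moreover have "word_perm is permutes {1..n}"
    using Cons by simp
  moreover have "word_perm (i # is) = transpose i (i + 1) \<circ> word_perm is"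
    by (simp add: word_perm_def fun_eq_iff)
  ultimately show ?case by (simp only: permutes_compose)
qed

theorem proposition5p2:
  shows "\<exists>n::nat. n > 0 \<and> (\<exists>w. w permutes {1..n} \<and> (\<exists>m. coeff (KN n w) m < 0))"
proof -
  define word where "word = (SOME is. reduced_word 4 witness is)"
  have five: "word_for 4 witness [2, 3, 1, 2, 1]"
    by (auto simp: word_for_def witness_def)
  then have "\<exists>is. reduced_word 4 witness is"
    using ex_has_least_nat[of "word_for 4 witness" _ length] by (auto simp: reduced_word_def)
  then have "reduced_word 4 witness word"
    unfolding word_def by (rule someI_ex)
  then have "set word \<subseteq> {1..<4}" "word_perm word = witness"
    and "length word \<le> length [2, 3, 1, 2, 1::nat]"
    using five unfolding reduced_word_def word_for_def by blast+
  then have "word \<in> set witness_words"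
    by (intro short_words_of_witness) simp_all
  then have "eval_poly (point 1 2 3 4) (KN 4 witness) < 0"
    using eval_witness_words[of word] by (simp add: KN_def T_perm_def word_def)
  then have "\<exists>m. coeff (KN 4 witness) m < 0"
    by (rule negative_coeff_if_eval_negative[rotated]) (simp add: point_def)
  moreover have "witness permutes {1..4}"
    unfolding witness_def by (rule word_perm_permutes) auto
  ultimately show ?thesis
    by (intro exI[of _ 4]) auto
qed

end
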